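(* Let $m\ge2$. For $q\in\Delta_m$ define $$H^{\mathrm r}_\beta(q)=\frac{\|q\|_\beta-1}{m^{1/\beta-1}-1}$$ if $\beta\in(0,1)\cup(1,\infty)$, and $H^{\mathrm r}_\beta(q)=\lim_{\beta'\to\beta}H^{\mathrm r}_{\beta'}(q)$ if $\beta=0,1,\infty$. Then the following proper scoring rules are obtained. (i) Simultaneous exponential loss ($\beta=0$): $L^{\mathrm r}_0(j,q)=\big(\prod_{k=1}^m\frac{q_k}{q_j}\big)^{1/m}$ corresponding to $H^{\mathrm r}_0(q)=m\big(\prod_{j=1}^mq_j\big)^{1/m}$. (ii) Pairwise exponential loss ($\beta=1/2$): $L^{\mathrm r}_{1/2}(j,q)=(m-1)^{-1}\sum_{k\in\{1,\ldots,m\},k\ne j}\sqrt{\frac{q_k}{q_j}}$ corresponding to $H^{\mathrm r}_{1/2}(q)=(m-1)^{-1}(\|q\|_{1/2}-1)$. (iii) Multinomial likelihood loss ($\beta=1$): $L^{\mathrm r}_1(j,q)=-(\log m)^{-1}\log q_j$ corresponding to $H^{\mathrm r}_1(q)=-(\log m)^{-1}\sum_{j=1}^mq_j\log q_j$. (iv) Multi-class zero-one loss ($\beta=\infty$): $L^{\mathrm r}_\infty(j,q)=(1-m^{-1})^{-1}\,1\{j\ne\mathrm{argmax}_{k\in\{1,\ldots,m\}}q_k\}$ corresponding to $H^{\mathrm r}_\infty(q)=(1-m^{-1})^{-1}(1-\max_{j\in\{1,\ldots,m\}}q_j)$. Moreover, with a multinomial logistic link $q^h=(q^h_1,\ldots,q^h_m)^{T}$,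 $q^h_j=\exp(h_j)/\sum_{k=1}^m\exp(h_k)$, $h=(h_1,\ldots,h_m)^{T}$, the composite loss $L^{\mathrm r}_\beta(j,q^h)$ is convex in $h$ if $\beta\in[0,1]$, but non-convex in $h$ if $\beta>1$.
   Context: $\Delta_m=\{q\in\mathbb R^m: q_j\ge 0,\ \sum_{j=1}^m q_j=1\}$ is the probability simplex, and $\|q\|_\beta=(\sum_{j=1}^mq_j^\beta)^{1/\beta}$. A scoring rule is a loss $L(j,q)$, with label $j\in\{1,\ldots,m\}$, whose action $q$ is a probability vector in $\Delta_m$. Its generalized entropy is $H_L(\eta)=\inf_{q\in\Delta_m}\sum_{j=1}^m\eta_jL(j,q)$ for $\eta\in\Delta_m$, and it is proper if $H_L(\eta)=\sum_{j=1}^m\eta_jL(j,\eta)$. A scoring rule "corresponds to" $H$ if it is proper with generalized entropy $H$. $L^{\mathrm r}_\beta$ denotes the proper scoring rule with generalized entropy $H^{\mathrm r}_\beta$; for $\beta\in(0,1)\cup(1,\infty)$ it is $$L^{\mathrm r}_\beta(j,q)=\frac{(q_j/\|q\|_\beta)^{\beta-1}-1}{m^{1/\beta-1}-1}.$$ $\mathrm{argmax}_kq_k$, if not unique, can be fixed as the index of any maximum component of $q$. *)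

theory Defs
  imports "HOL-Analysis.Analysis"
begin

text \<open>
  The label set is a finite type \<open>'m\<close>, so that \<open>m = CARD('m)\<close>. Losses take values in
  \<open>ereal\<close>, because several of them are infinite when the reported probability of the observed
  label is 0; in \<open>ereal\<close>, \<open>0 * \<infinity> = 0\<close>, which is the usual convention for expected losses.
\<close>

definition prob_simplex :: "(real ^ 'm) set" where
  "prob_simplex = {q. (\<forall>j. 0 \<le> q $ j) \<and> (\<Sum>j\<in>UNIV. q $ j) = 1}"

definition norm_beta :: "real \<Rightarrow> real ^ 'm \<Rightarrow> real" where
  "norm_beta b q = (\<Sum>j\<in>UNIV. (q $ j) powr b) powr (1 / b)"

definition gen_entropy :: "('m \<Rightarrow> real ^ 'm \<Rightarrow> ereal) \<Rightarrow> real ^ 'm \<Rightarrow> ereal" where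
  "gen_entropy L \<eta> = (INF q\<in>prob_simplex. \<Sum>j\<in>UNIV. ereal (\<eta> $ j) * L j q)"

definition proper_scoring_rule :: "('m \<Rightarrow> real ^ 'm \<Rightarrow> ereal) \<Rightarrow> bool" where
  "proper_scoring_rule L \<longleftrightarrow>
     (\<forall>\<eta>\<in>prob_simplex. gen_entropy L \<eta> = (\<Sum>j\<in>UNIV. ereal (\<eta> $ j) * L j \<eta>))"

definition corresponds_to ::
  "('m \<Rightarrow> real ^ 'm \<Rightarrow> ereal) \<Rightarrow> (real ^ 'm \<Rightarrow> real) \<Rightarrow> bool" where
  "corresponds_to L H \<longleftrightarrow>
     proper_scoring_rule L \<and> (\<forall>\<eta>\<in>prob_simplex. gen_entropy L \<eta> = ereal (H \<eta>))"

definition Hr_fin :: "real \<Rightarrow> real ^ 'm \<Rightarrow> real" where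
  "Hr_fin b q = (norm_beta b q - 1) / (real CARD('m) powr (1 / b - 1) - 1)"

text \<open>
  The exponent \<open>\<beta>\<close> ranges over \<open>[0, \<infinity>]\<close>. The three exceptional values are limits over the
  exponents in \<open>(0, 1) \<union> (1, \<infinity>)\<close>.
\<close>

definition Hr :: "ereal \<Rightarrow> real ^ 'm \<Rightarrow> real" where
  "Hr \<beta> q =
     (if \<beta> = 0 then Lim (at_right 0) (\<lambda>b. Hr_fin b q)
      else if \<beta> = 1 then Lim (at 1) (\<lambda>b. Hr_fin b q)
      else if \<beta> = \<infinity> then Lim at_top (\<lambda>b. Hr_fin b q)
      else Hr_fin (real_of_ereal \<beta>) q)"

text \<open>
  For \<open>b < 1\<close> the exponent \<open>b - 1\<close> is negative, so the loss is \<open>\<infinity>\<close> where \<open>q $ j = 0\<close>; this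
  has to be spelled out since \<open>0 powr x = 0\<close> for all \<open>x\<close>.
\<close>

definition Lr_fin :: "real \<Rightarrow> 'm \<Rightarrow> real ^ 'm \<Rightarrow> ereal" where
  "Lr_fin b j q =
     (if b < 1 \<and> q $ j = 0 then \<infinity>
      else ereal (((q $ j / norm_beta b q) powr (b - 1) - 1) /
                  (real CARD('m) powr (1 / b - 1) - 1)))"

text \<open>
  The argument \<open>am\<close> selects the index of a maximal component and is used only for \<open>\<beta> = \<infinity>\<close>.
  For \<open>\<beta> = 0\<close> the product is an indeterminate form on part of the boundary of the simplex;
  the value \<open>\<infinity>\<close> at \<open>q $ j = 0\<close> is the convention \<open>x / 0 = \<infinity>\<close> for
  \<open>(\<Prod>k. q $ k) powr (1 / m) / q $ j\<close>, and it is needed for properness.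
\<close>

definition Lr :: "(real ^ 'm \<Rightarrow> 'm) \<Rightarrow> ereal \<Rightarrow> 'm \<Rightarrow> real ^ 'm \<Rightarrow> ereal" where
  "Lr am \<beta> j q =
     (if \<beta> = 0 then
        (if q $ j = 0 then \<infinity>
         else ereal ((\<Prod>k\<in>UNIV. q $ k / q $ j) powr (1 / real CARD('m))))
      else if \<beta> = 1 then
        (if q $ j = 0 then \<infinity> else ereal (- (1 / ln (real CARD('m))) * ln (q $ j)))
      else if \<beta> = \<infinity> then
        ereal (1 / (1 - 1 / real CARD('m)) * of_bool (j \<noteq> am q))
      else Lr_fin (real_of_ereal \<beta>) j q)"

definition mlogit_link :: "real ^ 'm \<Rightarrow> real ^ 'm" where
  "mlogit_link h = (\<chi> j. exp (h $ j) / (\<Sum>k\<in>UNIV. exp (h $ k)))"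

end

theory Submission
  imports Defs
begin

text \<open>
  The closed form of the entropy comes from a derivative at \<open>b = 1\<close> and, for positive \<open>q\<close>, at \<open>b = 0\<close>;
  squeezing settles the boundary at \<open>0\<close> and the case \<open>\<infinity>\<close>. Properness amounts to AM-GM at \<open>0\<close>,
  Cauchy-Schwarz at \<open>1/2\<close> and Gibbs' inequality at \<open>1\<close>. For the composite losses put
  \<open>S h = (\<Sum>k. exp (b * (h $ k - h $ j)))\<close>; under the logistic link the loss at a finite \<open>b\<close>
  other than \<open>0\<close> and \<open>1\<close> is \<open>(S h powr (1 / b - 1) - 1) / (m powr (1 / b - 1) - 1)\<close>. For
  \<open>0 < b < 1\<close> it is an increasing affine function of \<open>exp ((1 / b - 1) * ln (S h))\<close>, which is
  convex because log-sum-exp is. For \<open>\<beta> > 1\<close> the loss is bounded, and a convex function on the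
  whole space that is bounded above is constant.
\<close>

subsection \<open>Properness\<close>

lemma prob_simplexD:
  assumes "q \<in> prob_simplex"
  shows "0 \<le> q $ j" "q $ j \<le> 1" "(\<Sum>j\<in>UNIV. q $ j) = 1"
proof -
  have nn: "0 \<le> q $ j" for j
    using assms by (simp add: prob_simplex_def)
  show s: "(\<Sum>j\<in>UNIV. q $ j) = 1"
    using assms by (simp add: prob_simplex_def)
  show "0 \<le> q $ j" by (rule nn)
  show "q $ j \<le> 1"
    using member_le_sum[of j UNIV "\<lambda>j. q $ j"] nn s by simp
qed

text \<open>The truthful report is one of the competitors in the infimum, so its expected loss
  bounds \<open>gen_entropy\<close> from above; the second premise is the matching lower
  bound.\<close>

lemma corresponds_toI:
  assumes "\<And>\<eta>. \<eta> \<in> prob_simplex \<Longrightarrow> (\<Sum>j\<in>UNIV. ereal (\<eta> $ j) * L j \<eta>) = ereal (H \<eta>)"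
    and "\<And>\<eta> q. \<eta> \<in> prob_simplex \<Longrightarrow> q \<in> prob_simplex \<Longrightarrow>
           ereal (H \<eta>) \<le> (\<Sum>j\<in>UNIV. ereal (\<eta> $ j) * L j q)"
  shows "corresponds_to L H"
proof -
  have "gen_entropy L \<eta> = ereal (H \<eta>)" if "\<eta> \<in> prob_simplex" for \<eta>
    unfolding gen_entropy_def using assms that
    by (intro antisym INF_greatest) (auto intro: INF_lower2)
  then show ?thesis
    using assms(1) by (simp add: corresponds_to_def proper_scoring_rule_def)
qed

text \<open>
  A report that rules out a label of positive probability has infinite expected loss, so
  only reports whose support contains that of \<open>\<eta>\<close> have to be compared.
\<close>

lemma corresponds_toI_infinite:
  fixes L :: "'m::finite \<Rightarrow> real ^ 'm \<Rightarrow> ereal"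
  assumes L: "\<And>j q. q \<in> prob_simplex \<Longrightarrow> L j q = (if q $ j = 0 then \<infinity> else ereal (l j q))"
    and eq: "\<And>\<eta>. \<eta> \<in> prob_simplex \<Longrightarrow> (\<Sum>j\<in>UNIV. \<eta> $ j * l j \<eta>) = H \<eta>"
    and le: "\<And>\<eta> q. \<eta> \<in> prob_simplex \<Longrightarrow> q \<in> prob_simplex \<Longrightarrow>
           (\<And>j. q $ j = 0 \<Longrightarrow> \<eta> $ j = 0) \<Longrightarrow> H \<eta> \<le> (\<Sum>j\<in>UNIV. \<eta> $ j * l j q)"
  shows "corresponds_to L H"
proof -
  have fin: "(\<Sum>j\<in>UNIV. ereal (\<eta> $ j) * L j q) = ereal (\<Sum>j\<in>UNIV. \<eta> $ j * l j q)"
    if "q \<in> prob_simplex" "\<And>j. q $ j = 0 \<Longrightarrow> \<eta> $ j = 0" for \<eta> q :: "real ^ 'm"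
  proof -
    \<comment> \<open>Where \<open>q $ j = 0\<close>, also \<open>\<eta> $ j = 0\<close>, so both
      sides are 0: on the left 0 * \<infinity> = 0, on the right whatever value \<open>l j q\<close>
      takes.\<close>
    have "ereal (\<eta> $ j) * L j q = ereal (\<eta> $ j * l j q)" for j
      using that L[of q j] by (cases "q $ j = 0") auto
    then show ?thesis by simp
  qed
  show ?thesis
  proof (rule corresponds_toI)
    fix \<eta> q :: "real ^ 'm" assume \<eta>: "\<eta> \<in> prob_simplex" and q: "q \<in> prob_simplex"
    show "ereal (H \<eta>) \<le> (\<Sum>j\<in>UNIV. ereal (\<eta> $ j) * L j q)"
    proof (cases "\<forall>j. q $ j = 0 \<longrightarrow> \<eta> $ j = 0")
      case True
      then show ?thesis using fin[OF q] le[OF \<eta> q] by simp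
    next
      case False
      then obtain j where "q $ j = 0" "\<eta> $ j \<noteq> 0" by auto
      then have "ereal (\<eta> $ j) * L j q = \<infinity>"
        using L[OF q] prob_simplexD(1)[OF \<eta>, of j] by simp
      \<comment> \<open>In \<open>ereal\<close> a single summand \<infinity> makes a finite sum
        \<infinity>, whatever the other summands are.\<close>
      then have "(\<Sum>j\<in>UNIV. ereal (\<eta> $ j) * L j q) = \<infinity>"
        by (subst sum_Pinfty) auto
      then show ?thesis by simp
    qed
  qed (use fin eq in simp)
qed

lemma corresponds_to_cong:
  assumes "\<And>q. q \<in> prob_simplex \<Longrightarrow> H q = H' q"
  shows "corresponds_to L H \<longleftrightarrow> corresponds_to L H'"
  using assms by (auto simp: corresponds_to_def)

section \<open>Properness of the four special losses\<close>

lemma geometric_mean_ratio: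
  fixes q :: "real ^ 'm::finite"
  assumes "\<And>k. 0 \<le> q $ k" "0 < q $ j"
  shows "(\<Prod>k\<in>UNIV. q $ k / q $ j) powr (1 / real CARD('m)) =
         (\<Prod>k\<in>UNIV. q $ k) powr (1 / real CARD('m)) / q $ j"
proof -
  have "(q $ j ^ CARD('m)) powr (1 / real CARD('m)) = q $ j"
    using assms(2) by (simp add: powr_realpow[symmetric] powr_powr)
  then show ?thesis
    using assms by (simp add: prod_dividef powr_divide prod_nonneg)
qed

text \<open>The loss is \<open>G q / q $ j\<close> with \<open>G\<close> the geometric mean. For
  positive \<open>\<eta>\<close> and \<open>q\<close> the product of the terms
  \<open>\<eta> $ j * l j q\<close> does not depend on \<open>q\<close>, so AM-GM bounds their sum
  below by m times \<open>G \<eta>\<close>, and truthful reporting makes all terms equal.\<close>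

lemma corresponds_to_exponential:
  "corresponds_to (Lr am 0)
     (\<lambda>q :: real ^ 'm::finite. real CARD('m) * (\<Prod>j\<in>UNIV. q $ j) powr (1 / real CARD('m)))"
proof -
  define G where "G q = (\<Prod>j\<in>UNIV. q $ j) powr (1 / real CARD('m))" for q :: "real ^ 'm"
  define l where "l j q = (\<Prod>k\<in>UNIV. q $ k / q $ j) powr (1 / real CARD('m))" for j and q :: "real ^ 'm"
  have l: "l j q = G q / q $ j" if "q \<in> prob_simplex" "q $ j \<noteq> 0" for j q
    using geometric_mean_ratio[of q j] prob_simplexD(1)[OF that(1)] that(2)
    by (simp add: l_def G_def less_le)
  have G0: "G q = 0" if "q $ j = 0" for q j
    using that by (auto simp: G_def)
  have "corresponds_to (Lr am 0) (\<lambda>q. real CARD('m) * G q)"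
  proof (rule corresponds_toI_infinite)
    fix \<eta> :: "real ^ 'm" assume \<eta>: "\<eta> \<in> prob_simplex"
    have "\<eta> $ j * l j \<eta> = G \<eta>" for j
      using l[OF \<eta>, of j] G0[of \<eta> j] by (cases "\<eta> $ j = 0") auto
    then show "(\<Sum>j\<in>UNIV. \<eta> $ j * l j \<eta>) = real CARD('m) * G \<eta>" by simp
  next
    fix \<eta> q :: "real ^ 'm" assume \<eta>: "\<eta> \<in> prob_simplex" and q: "q \<in> prob_simplex"
      and supp: "\<And>j. q $ j = 0 \<Longrightarrow> \<eta> $ j = 0"
    note nn = prob_simplexD(1)[OF \<eta>] prob_simplexD(1)[OF q]
    show "real CARD('m) * G \<eta> \<le> (\<Sum>j\<in>UNIV. \<eta> $ j * l j q)"
    \<comment> \<open>If \<open>\<eta>\<close> has a zero component, the entropy is 0 and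
      nonnegativity of the loss suffices. Otherwise the support condition makes \<open>q\<close>
      positive.\<close>
    proof (cases "\<exists>j. \<eta> $ j = 0")
      case True
      then have "G \<eta> = 0" using G0 by blast
      then show ?thesis using nn by (auto simp: l_def intro!: sum_nonneg)
    next
      case False
      then have qpos: "q $ j > 0" for j using supp nn by (metis less_le)
      have Gpow: "G q ^ CARD('m) = (\<Prod>j\<in>UNIV. q $ j)"
        using qpos by (simp add: G_def powr_realpow[symmetric] powr_powr prod_pos less_imp_neq[symmetric]
            abs_of_pos)
      have "(\<Prod>j\<in>UNIV. \<eta> $ j * l j q) = (\<Prod>j\<in>UNIV. \<eta> $ j * (G q / q $ j))"
        using l[OF q] qpos by (simp add: less_imp_neq[symmetric])
      \<comment> \<open>The m factors \<open>G q\<close> multiply to the product of all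
        \<open>q $ j\<close> and cancel the denominators.\<close>
      also have "\<dots> = (\<Prod>j\<in>UNIV. \<eta> $ j)"
        using qpos by (simp add: prod.distrib prod_dividef Gpow less_imp_neq[symmetric])
      finally have "G \<eta> \<le> (\<Sum>j\<in>UNIV. \<eta> $ j * l j q / real CARD('m))"
        using arith_geom_mean[of UNIV "\<lambda>j. \<eta> $ j * l j q"] nn by (simp add: G_def l_def)
      then show ?thesis by (simp add: sum_divide_distrib[symmetric] field_simps)
    qed
  qed (simp add: Lr_def l_def)
  then show ?thesis by (simp add: G_def)
qed

lemma norm_beta_half:
  assumes "q \<in> prob_simplex"
  shows "norm_beta (1/2) q = (\<Sum>j\<in>UNIV. sqrt (q $ j))\<^sup>2"
  using prob_simplexD(1)[OF assms]
  by (simp add: norm_beta_def powr_half_sqrt sum_nonneg flip: powr_numeral)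

text \<open>The 1 that is subtracted is the omitted diagonal term \<open>k = j\<close>.\<close>

lemma sum_sqrt_ratio:
  fixes q :: "real ^ 'm::finite"
  assumes "q $ j \<noteq> 0"
  shows "(\<Sum>k\<in>UNIV - {j}. sqrt (q $ k / q $ j)) = (\<Sum>k\<in>UNIV. sqrt (q $ k)) / sqrt (q $ j) - 1"
  using assms by (simp add: sum.remove[of UNIV j] real_sqrt_divide sum_divide_distrib add_divide_distrib)

lemma Lr_half:
  fixes am :: "real ^ 'm \<Rightarrow> 'm::finite"
  assumes m: "CARD('m) \<ge> 2" and q: "q \<in> prob_simplex"
  shows "Lr am (ereal (1/2)) j q =
         (if q $ j = 0 then \<infinity>
          else ereal (1 / (real CARD('m) - 1) * (\<Sum>k\<in>UNIV - {j}. sqrt (q $ k / q $ j))))"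
proof (cases "q $ j = 0")
  case False
  define S where "S = (\<Sum>k\<in>UNIV. sqrt (q $ k))"
  have pos: "q $ j > 0" using prob_simplexD(1)[OF q, of j] False by simp
  have "sqrt (q $ j) \<le> S"
    unfolding S_def using prob_simplexD(1)[OF q] by (intro member_le_sum) auto
  then have S: "S > 0" using pos by (rule less_le_trans[OF real_sqrt_gt_zero, rotated])
  \<comment> \<open>The norm is the square of \<open>S\<close>, and the exponent -1/2 turns the
    quotient into the square root of its reciprocal.\<close>
  have "(q $ j / norm_beta (1/2) q) powr (1/2 - 1) = S / sqrt (q $ j)"
    using S pos
    by (simp add: norm_beta_half[OF q] S_def[symmetric] powr_minus powr_half_sqrt real_sqrt_divide
        inverse_eq_divide)
  also have "\<dots> - 1 = (\<Sum>k\<in>UNIV - {j}. sqrt (q $ k / q $ j))"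
    using False by (simp add: S_def sum_sqrt_ratio)
  finally show ?thesis
    using False m by (simp add: Lr_def Lr_fin_def)
qed (simp add: Lr_def Lr_fin_def)

lemma Hr_half:
  "Hr (ereal (1/2)) (q :: real ^ 'm::finite) = 1 / (real CARD('m) - 1) * (norm_beta (1/2) q - 1)"
  by (simp add: Hr_def Hr_fin_def)

lemma corresponds_to_pairwise:
  fixes am :: "real ^ 'm \<Rightarrow> 'm::finite"
  assumes m: "CARD('m) \<ge> 2"
  shows "corresponds_to (Lr am (ereal (1/2))) (Hr (ereal (1/2)))"
proof (rule corresponds_toI_infinite)
  define S where "S q = (\<Sum>k\<in>UNIV. sqrt (q $ k))" for q :: "real ^ 'm"
  define l where "l j q = 1 / (real CARD('m) - 1) * (\<Sum>k\<in>UNIV - {j}. sqrt (q $ k / q $ j))"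
    for j and q :: "real ^ 'm"
  show "Lr am (ereal (1/2)) j q = (if q $ j = 0 then \<infinity> else ereal (l j q))"
    if "q \<in> prob_simplex" for j q
    unfolding l_def by (rule Lr_half[OF m that])
  have l: "l j q = 1 / (real CARD('m) - 1) * (S q / sqrt (q $ j) - 1)" if "q $ j \<noteq> 0" for j q
    using that by (simp only: l_def S_def sum_sqrt_ratio[OF that])
  have sum: "(\<Sum>j\<in>UNIV. \<eta> $ j * l j q) =
      1 / (real CARD('m) - 1) * ((\<Sum>j\<in>UNIV. \<eta> $ j / sqrt (q $ j)) * S q - 1)"
    if "\<eta> \<in> prob_simplex" "\<And>j. q $ j = 0 \<Longrightarrow> \<eta> $ j = 0" for \<eta> q
  proof -
    \<comment> \<open>Since the \<open>\<eta> $ j\<close> sum to 1, the last terms add up to the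
      constant -1. Where \<open>q $ j = 0\<close>, both sides vanish with
      \<open>\<eta> $ j\<close>.\<close>
    have "\<eta> $ j * l j q = 1 / (real CARD('m) - 1) * (\<eta> $ j / sqrt (q $ j) * S q - \<eta> $ j)" for j
    proof (cases "q $ j = 0")
      case False
      have "x * (c * (t / s - 1)) = c * (x / s * t - x)" for x c s t :: real
        by (simp add: algebra_simps)
      then show ?thesis by (simp only: l[OF False])
    qed (use that(2) in simp)
    then show ?thesis
      using prob_simplexD(3)[OF that(1)]
      by (simp add: sum_distrib_left[symmetric] sum_distrib_right sum_subtractf
            sum_divide_distrib[symmetric])
  qed
  have H: "Hr (ereal (1/2)) \<eta> = 1 / (real CARD('m) - 1) * ((S \<eta>)\<^sup>2 - 1)"
    if "\<eta> \<in> prob_simplex" for \<eta> :: "real ^ 'm"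
    by (simp only: Hr_half norm_beta_half[OF that] S_def)
  {
    fix \<eta> :: "real ^ 'm" assume \<eta>: "\<eta> \<in> prob_simplex"
    have "(\<Sum>j\<in>UNIV. \<eta> $ j / sqrt (\<eta> $ j)) = S \<eta>"
      unfolding S_def using prob_simplexD(1)[OF \<eta>] by (simp add: real_div_sqrt)
    then show "(\<Sum>j\<in>UNIV. \<eta> $ j * l j \<eta>) = Hr (ereal (1/2)) \<eta>"
      by (simp only: sum[OF \<eta>] H[OF \<eta>] power2_eq_square)
  next
    fix \<eta> q :: "real ^ 'm" assume \<eta>: "\<eta> \<in> prob_simplex" and q: "q \<in> prob_simplex"
      and supp: "\<And>j. q $ j = 0 \<Longrightarrow> \<eta> $ j = 0"
    note nn = prob_simplexD(1)[OF \<eta>] prob_simplexD(1)[OF q]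
    \<comment> \<open>Chosen so that the squares of \<open>a\<close> and \<open>b\<close> sum to the
      two factors of the expected loss, while \<open>a j * b j\<close> is free of \<open>q\<close>.
      Where \<open>q $ j = 0\<close>, the support condition makes both sides of the product identity
      0.\<close>
    define a b where "a j = sqrt (\<eta> $ j / sqrt (q $ j))" and "b j = sqrt (sqrt (q $ j))" for j
    have "a j * b j = sqrt (\<eta> $ j)" for j
      using supp[of j] by (cases "q $ j = 0") (auto simp: a_def b_def real_sqrt_divide)
    then have "(S \<eta>)\<^sup>2 \<le> (\<Sum>j\<in>UNIV. \<eta> $ j / sqrt (q $ j)) * S q"
      using Cauchy_Schwarz_ineq_sum[of a b UNIV] nn by (simp add: S_def a_def b_def)
    then have "Hr (ereal (1/2)) \<eta> \<le>
        1 / (real CARD('m) - 1) * ((\<Sum>j\<in>UNIV. \<eta> $ j / sqrt (q $ j)) * S q - 1)"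
      unfolding H[OF \<eta>] using m by (intro mult_left_mono) auto
    also have "\<dots> = (\<Sum>j\<in>UNIV. \<eta> $ j * l j q)"
      using supp by (rule sum[OF \<eta>, symmetric])
    finally show "Hr (ereal (1/2)) \<eta> \<le> (\<Sum>j\<in>UNIV. \<eta> $ j * l j q)" .
  }
qed

lemma corresponds_to_log:
  assumes m: "CARD('m::finite) \<ge> 2"
  shows "corresponds_to (Lr am 1)
     (\<lambda>q :: real ^ 'm. - (1 / ln (real CARD('m))) * (\<Sum>j\<in>UNIV. q $ j * ln (q $ j)))"
proof (rule corresponds_toI_infinite)
  define c where "c = 1 / ln (real CARD('m))"
  have c: "c \<ge> 0" unfolding c_def using m by simp
  define l where "l j q = - c * ln (q $ j)" for j and q :: "real ^ 'm"
  show "Lr am 1 j q = (if q $ j = 0 then \<infinity> else ereal (l j q))" for j and q :: "real ^ 'm"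
    by (simp add: Lr_def l_def c_def)
  have sum: "(\<Sum>j\<in>UNIV. \<eta> $ j * l j q) = - c * (\<Sum>j\<in>UNIV. \<eta> $ j * ln (q $ j))" for \<eta> q
    by (simp add: l_def sum_distrib_left algebra_simps)
  then show "(\<Sum>j\<in>UNIV. \<eta> $ j * l j \<eta>) =
      - (1 / ln (real CARD('m))) * (\<Sum>j\<in>UNIV. \<eta> $ j * ln (\<eta> $ j))" for \<eta>
    by (simp add: c_def)
  fix \<eta> q :: "real ^ 'm" assume \<eta>: "\<eta> \<in> prob_simplex" and q: "q \<in> prob_simplex"
    and supp: "\<And>j. q $ j = 0 \<Longrightarrow> \<eta> $ j = 0"
  \<comment> \<open>This is ln x \<le> x - 1 at \<open>q $ j / \<eta> $ j\<close>, multiplied by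
    \<open>\<eta> $ j\<close>. The corrections \<open>q $ j - \<eta> $ j\<close> sum to 0 because
    both vectors lie in the simplex.\<close>
  have "\<eta> $ j * ln (q $ j) \<le> \<eta> $ j * ln (\<eta> $ j) + (q $ j - \<eta> $ j)" for j
  proof (cases "\<eta> $ j = 0")
    case False
    then have pos: "\<eta> $ j > 0" "q $ j > 0"
      using supp[of j] prob_simplexD(1)[OF \<eta>, of j] prob_simplexD(1)[OF q, of j]
      by (auto simp: less_le)
    then have "ln (q $ j) - ln (\<eta> $ j) \<le> q $ j / \<eta> $ j - 1"
      using ln_le_minus_one[of "q $ j / \<eta> $ j"] by (simp add: ln_div)
    from mult_left_mono[OF this, of "\<eta> $ j"] show ?thesis
      using pos by (simp add: algebra_simps)
  qed (use prob_simplexD(1)[OF q] in simp)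
  then have "(\<Sum>j\<in>UNIV. \<eta> $ j * ln (q $ j)) \<le>
      (\<Sum>j\<in>UNIV. \<eta> $ j * ln (\<eta> $ j) + (q $ j - \<eta> $ j))"
    by (rule sum_mono)
  then have "(\<Sum>j\<in>UNIV. \<eta> $ j * ln (q $ j)) \<le> (\<Sum>j\<in>UNIV. \<eta> $ j * ln (\<eta> $ j))"
    by (simp add: sum.distrib sum_subtractf prob_simplexD(3)[OF \<eta>] prob_simplexD(3)[OF q])
  then show "- (1 / ln (real CARD('m))) * (\<Sum>j\<in>UNIV. \<eta> $ j * ln (\<eta> $ j)) \<le> (\<Sum>j\<in>UNIV. \<eta> $ j * l j q)"
    unfolding sum c_def[symmetric] using c by (simp add: mult_left_mono)
qed

text \<open>The expected loss sees \<open>q\<close> only through the selected label: it is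
  \<open>c * (1 - \<eta> $ am q)\<close>, smallest when that label is a maximal component of
  \<open>\<eta>\<close>.\<close>

lemma corresponds_to_zero_one:
  fixes am :: "real ^ 'm \<Rightarrow> 'm::finite"
  assumes am: "\<And>q. q \<in> prob_simplex \<Longrightarrow> is_arg_max (\<lambda>k. q $ k) (\<lambda>k. True) (am q)"
  shows "corresponds_to (Lr am \<infinity>)
     (\<lambda>q. 1 / (1 - 1 / real CARD('m)) * (1 - (MAX j\<in>UNIV. q $ j)))"
proof -
  define c where "c = 1 / (1 - 1 / real CARD('m))"
  \<comment> \<open>With a single label \<open>c\<close> is 1 / 0 = 0.\<close>
  have c: "c \<ge> 0" unfolding c_def by (simp add: Suc_le_eq)
  have sum: "(\<Sum>j\<in>UNIV. ereal (\<eta> $ j) * Lr am \<infinity> j q) = ereal (c * (1 - \<eta> $ am q))"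
    if "\<eta> \<in> prob_simplex" for \<eta> q
  proof -
    have "(\<Sum>j\<in>UNIV. \<eta> $ j * (c * of_bool (j \<noteq> am q))) = (\<Sum>j\<in>UNIV - {am q}. c * \<eta> $ j)"
      by (rule sum.mono_neutral_cong_right) auto
    also have "\<dots> = c * (1 - \<eta> $ am q)"
      using prob_simplexD(3)[OF that]
      by (simp add: sum_distrib_left[symmetric] sum.remove[of UNIV "am q"])
    finally show ?thesis by (simp add: Lr_def c_def[symmetric])
  qed
  have "corresponds_to (Lr am \<infinity>) (\<lambda>q. c * (1 - (MAX j\<in>UNIV. q $ j)))"
  proof (rule corresponds_toI)
    fix \<eta> :: "real ^ 'm" assume \<eta>: "\<eta> \<in> prob_simplex"
    have "(MAX j\<in>UNIV. \<eta> $ j) = \<eta> $ am \<eta>"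
      using am[OF \<eta>] by (intro Max_eqI) (auto simp: is_arg_max_def not_less)
    then show "(\<Sum>j\<in>UNIV. ereal (\<eta> $ j) * Lr am \<infinity> j \<eta>) = ereal (c * (1 - (MAX j\<in>UNIV. \<eta> $ j)))"
      by (simp add: sum[OF \<eta>])
    fix q :: "real ^ 'm"
    have "\<eta> $ am q \<le> (MAX j\<in>UNIV. \<eta> $ j)" by simp
    then show "ereal (c * (1 - (MAX j\<in>UNIV. \<eta> $ j))) \<le> (\<Sum>j\<in>UNIV. ereal (\<eta> $ j) * Lr am \<infinity> j q)"
      unfolding sum[OF \<eta>] ereal_less_eq using c by (intro mult_left_mono) auto
  qed
  then show ?thesis by (simp add: c_def)
qed

subsection \<open>Limits of the entropy\<close>

lemma powr_tendsto_0_at_right: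
  fixes a :: real
  assumes "0 < a" "a < 1"
  shows "((\<lambda>b. a powr (1 / b)) \<longlongrightarrow> 0) (at_right 0)"
proof -
  have "LIM b at_right 0. ln a * inverse b :> at_bot"
    using assms
    by (intro filterlim_tendsto_neg_mult_at_bot[OF tendsto_const] filterlim_inverse_at_top_right) auto
  from filterlim_compose[OF exp_at_bot this] show ?thesis
    using assms by (simp add: powr_def field_simps)
qed

text \<open>The denominator diverges as b tends to 0. Dividing numerator and denominator by m^(1/b -
  1) leaves the power mean \<open>g b powr (1 / b)\<close>, which tends to the geometric mean, and
  corrections m^(1 - 1/b) that vanish.\<close>

lemma Hr_fin_tendsto_0:
  fixes q :: "real ^ 'm::finite"
  assumes m: "CARD('m) \<ge> 2" and q: "q \<in> prob_simplex"
  shows "((\<lambda>b. Hr_fin b q) \<longlongrightarrow> real CARD('m) * (\<Prod>j\<in>UNIV. q $ j) powr (1 / real CARD('m))) (at_right 0)"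
proof -
  define M where "M = real CARD('m)"
  have M: "M \<ge> 2" using m by (simp add: M_def)
  define g where "g b = (\<Sum>j\<in>UNIV. (q $ j) powr b) / M" for b
  note nn = prob_simplexD(1)[OF q]
  have g_nn: "g b \<ge> 0" for b
    unfolding g_def using M by (intro divide_nonneg_nonneg sum_nonneg) auto
  have lim_g: "((\<lambda>b. g b powr (1 / b)) \<longlongrightarrow> (\<Prod>j\<in>UNIV. q $ j) powr (1 / M)) (at_right 0)"
  proof (cases "\<exists>j. q $ j = 0")
    case True
    then obtain i where i: "q $ i = 0" by auto
    \<comment> \<open>The zero component drops out and the remaining M - 1 terms are at most 1. A
      base bounded away from 1 forces the power \<open>1 / b\<close> to 0.\<close>
    have "g b \<le> 1 - 1 / M" if "b > 0" for b
    proof -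
      have "(\<Sum>j\<in>UNIV. (q $ j) powr b) = (\<Sum>j\<in>UNIV - {i}. (q $ j) powr b)"
        using i by (simp add: sum.remove[of UNIV i])
      also have "\<dots> \<le> (\<Sum>j\<in>UNIV - {i}. 1)"
        using that nn prob_simplexD(2)[OF q] by (intro sum_mono) (simp add: powr_le1)
      also have "\<dots> = M - 1" using m by (simp add: M_def)
      finally show ?thesis using M by (simp add: g_def field_simps)
    qed
    then have le: "\<forall>\<^sub>F b in at_right 0. g b powr (1 / b) \<le> (1 - 1 / M) powr (1 / b)"
      using g_nn by (auto simp: eventually_at_filter intro!: always_eventually powr_mono2)
    have "((\<lambda>b. (1 - 1 / M) powr (1 / b)) \<longlongrightarrow> 0) (at_right 0)"
      using M by (intro powr_tendsto_0_at_right) auto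
    then have "((\<lambda>b. g b powr (1 / b)) \<longlongrightarrow> 0) (at_right 0)"
      by (rule tendsto_sandwich[OF _ le tendsto_const, rotated]) auto
    moreover have "(\<Prod>j\<in>UNIV. q $ j) powr (1 / M) = 0" using i by auto
    ultimately show ?thesis by (simp only:)
  next
    case False
    then have pos: "q $ j > 0" for j using nn by (metis less_le)
    have g0: "g 0 = 1" using pos M by (simp add: g_def M_def less_imp_neq[symmetric])
    have gpos: "g b > 0" for b
      unfolding g_def using pos M by (intro divide_pos_pos sum_pos) (auto simp: less_imp_neq[symmetric])
    \<comment> \<open>As \<open>ln (g 0) = 0\<close>, the difference quotient at 0 is
      \<open>ln (g b) / b\<close>, the logarithm of the power mean.\<close>
    have "((\<lambda>b. ln (g b)) has_real_derivative (\<Sum>j\<in>UNIV. ln (q $ j)) / M) (at 0)"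
    proof -
      have "(g has_real_derivative (\<Sum>j\<in>UNIV. ln (q $ j)) / M) (at 0)"
        unfolding g_def using pos M
        by (auto intro!: derivative_eq_intros simp: less_imp_neq[symmetric])
      from DERIV_chain2[OF DERIV_ln_divide this] g0 show ?thesis by simp
    qed
    then have "((\<lambda>b. ln (g b) / b) \<longlongrightarrow> (\<Sum>j\<in>UNIV. ln (q $ j)) / M) (at 0)"
      by (simp add: has_field_derivative_iff g0)
    then have "((\<lambda>b. exp (ln (g b) / b)) \<longlongrightarrow> exp ((\<Sum>j\<in>UNIV. ln (q $ j)) / M)) (at_right 0)"
      by (intro tendsto_exp) (rule filterlim_mono, auto simp: at_le)
    moreover have "exp (ln (g b) / b) = g b powr (1 / b)" for b
      using gpos[of b] by (simp add: powr_def)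
    moreover have "exp ((\<Sum>j\<in>UNIV. ln (q $ j)) / M) = (\<Prod>j\<in>UNIV. q $ j) powr (1 / M)"
      using pos by (simp add: powr_def ln_prod prod_pos less_imp_neq[symmetric])
    ultimately show ?thesis by simp
  qed
  have "((\<lambda>b. M * (1 / M) powr (1 / b)) \<longlongrightarrow> M * 0) (at_right 0)"
    using M by (intro tendsto_mult_left powr_tendsto_0_at_right) auto
  then have M1: "((\<lambda>b. M powr (1 - 1 / b)) \<longlongrightarrow> 0) (at_right 0)"
    using M by (simp add: powr_diff powr_divide)
  have "((\<lambda>b. (M * g b powr (1 / b) - M powr (1 - 1 / b)) / (1 - M powr (1 - 1 / b)))
      \<longlongrightarrow> (M * (\<Prod>j\<in>UNIV. q $ j) powr (1 / M) - 0) / (1 - 0)) (at_right 0)"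
    by (intro tendsto_intros lim_g M1) auto
  moreover have "Hr_fin b q = (M * g b powr (1 / b) - M powr (1 - 1 / b)) / (1 - M powr (1 - 1 / b))" for b
  proof -
    have "norm_beta b q = (M * g b) powr (1 / b)" using M by (simp add: norm_beta_def g_def)
    also have "\<dots> = M powr (1 / b) * g b powr (1 / b)" using M g_nn by (simp add: powr_mult)
    also have "\<dots> = M powr (1 / b - 1) * (M * g b powr (1 / b))"
      using M by (simp add: powr_diff)
    finally have n: "norm_beta b q = M powr (1 / b - 1) * (M * g b powr (1 / b))" .
    have p: "M powr (1 - 1 / b) = inverse (M powr (1 / b - 1))"
      by (simp flip: powr_minus)
    \<comment> \<open>At x = 1, which occurs for b = 1, both sides are divisions by 0 and hence
      0.\<close>
    have "(x * y - 1) / (x - 1) = (y - inverse x) / (1 - inverse x)" if "x > 0" for x y :: real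
    proof -
      have "y - inverse x = (x * y - 1) / x" "1 - inverse x = (x - 1) / x"
        using that by (simp_all add: field_simps)
      then show ?thesis using that by simp
    qed
    from this[of "M powr (1 / b - 1)"] show ?thesis
      unfolding Hr_fin_def n p M_def[symmetric] using M by simp
  qed
  ultimately show ?thesis by (simp add: M_def)
qed

text \<open>Numerator and denominator both vanish at b = 1, so after division of each by
  \<open>b - 1\<close> the limit is the quotient of their derivatives there.\<close>

lemma Hr_fin_tendsto_1:
  fixes q :: "real ^ 'm::finite"
  assumes m: "CARD('m) \<ge> 2" and q: "q \<in> prob_simplex"
  shows "((\<lambda>b. Hr_fin b q) \<longlongrightarrow> - (1 / ln (real CARD('m))) * (\<Sum>j\<in>UNIV. q $ j * ln (q $ j))) (at 1)"
proof -
  define M where "M = real CARD('m)"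
  have M: "M \<ge> 2" using m by (simp add: M_def)
  note nn = prob_simplexD(1)[OF q]
  define S where "S b = (\<Sum>j\<in>UNIV. (q $ j) powr b)" for b
  have S1: "S 1 = 1" using nn prob_simplexD(3)[OF q] by (simp add: S_def)
  \<comment> \<open>For \<open>q $ j = 0\<close> the function is constantly 0, in agreement with 0 *
    ln 0 = 0.\<close>
  have "((\<lambda>b. (q $ j) powr b) has_real_derivative q $ j * ln (q $ j)) (at 1)" for j
    using nn[of j] by (cases "q $ j = 0") (auto intro!: derivative_eq_intros)
  then have S': "(S has_real_derivative (\<Sum>j\<in>UNIV. q $ j * ln (q $ j))) (at 1)"
    unfolding S_def by (intro DERIV_sum) auto
  \<comment> \<open>The varying outer exponent contributes a multiple of \<open>ln (S 1)\<close>,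
    which is 0.\<close>
  have "((\<lambda>b. S b powr (1 / b)) has_real_derivative (\<Sum>j\<in>UNIV. q $ j * ln (q $ j))) (at 1)"
  proof -
    have "((\<lambda>b. 1 / b) has_real_derivative - 1) (at 1)"
      by (auto intro!: derivative_eq_intros)
    from DERIV_powr[OF S' _ this] show ?thesis by (simp add: S1)
  qed
  then have N: "((\<lambda>b. (norm_beta b q - 1) / (b - 1)) \<longlongrightarrow> (\<Sum>j\<in>UNIV. q $ j * ln (q $ j))) (at 1)"
    by (simp add: has_field_derivative_iff S1 norm_beta_def flip: S_def)
  have "((\<lambda>b. M powr (1 / b - 1)) has_real_derivative - ln M) (at 1)"
  proof -
    have "((\<lambda>b. 1 / b - 1) has_real_derivative - 1) (at 1)"
      by (auto intro!: derivative_eq_intros)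
    from DERIV_powr[OF DERIV_const[of M] _ this] show ?thesis using M by simp
  qed
  then have D: "((\<lambda>b. (M powr (1 / b - 1) - 1) / (b - 1)) \<longlongrightarrow> - ln M) (at 1)"
    using M by (simp add: has_field_derivative_iff)
  have "((\<lambda>b. ((norm_beta b q - 1) / (b - 1)) / ((M powr (1 / b - 1) - 1) / (b - 1)))
     \<longlongrightarrow> (\<Sum>j\<in>UNIV. q $ j * ln (q $ j)) / - ln M) (at 1)"
    using M by (intro tendsto_divide N D) auto
  moreover have "\<forall>\<^sub>F b in at 1.
      ((norm_beta b q - 1) / (b - 1)) / ((M powr (1 / b - 1) - 1) / (b - 1)) = Hr_fin b q"
    by (auto simp: eventually_at_filter Hr_fin_def M_def)
  ultimately show ?thesis
    by (simp add: M_def filterlim_cong)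
qed

text \<open>The norm is squeezed between the largest component \<open>x\<close> and
  \<open>M powr (1 / b) * x\<close>, whose first factor tends to 1.\<close>

lemma Hr_fin_tendsto_infinity:
  fixes q :: "real ^ 'm::finite"
  assumes m: "CARD('m) \<ge> 2" and q: "q \<in> prob_simplex"
  shows "((\<lambda>b. Hr_fin b q) \<longlongrightarrow> 1 / (1 - 1 / real CARD('m)) * (1 - (MAX j\<in>UNIV. q $ j))) at_top"
proof -
  define M where "M = real CARD('m)"
  have M: "M \<ge> 2" using m by (simp add: M_def)
  note nn = prob_simplexD(1)[OF q]
  define x where "x = (MAX j\<in>UNIV. q $ j)"
  have "x \<in> range (\<lambda>j. q $ j)" unfolding x_def by (intro Max_in) auto
  then obtain i where i: "x = q $ i" by auto
  have le: "q $ j \<le> x" for j by (simp add: x_def)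
  have x: "x \<ge> 0" using nn i by simp
  have lower: "x \<le> norm_beta b q" if "b > 0" for b
  proof -
    have "x powr b \<le> (\<Sum>j\<in>UNIV. (q $ j) powr b)"
      unfolding i by (intro member_le_sum) auto
    from powr_mono2[OF _ _ this, of "1 / b"] show ?thesis
      using that x by (simp add: norm_beta_def powr_powr)
  qed
  have upper: "norm_beta b q \<le> M powr (1 / b) * x" if "b > 0" for b
  proof -
    have "(\<Sum>j\<in>UNIV. (q $ j) powr b) \<le> M * x powr b"
      unfolding M_def using that nn le
      by (intro order.trans[OF sum_bounded_above[of UNIV _ "x powr b"]]) (auto intro: powr_mono2)
    from powr_mono2[OF _ _ this, of "1 / b"] show ?thesis
      using that x M by (simp add: norm_beta_def powr_powr powr_mult sum_nonneg)
  qed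
  have inv: "((\<lambda>b::real. 1 / b) \<longlongrightarrow> 0) at_top"
    using tendsto_inverse_0_at_top[OF filterlim_ident] by (simp add: inverse_eq_divide)
  have "((\<lambda>b. M powr (1 / b)) \<longlongrightarrow> M powr 0) at_top"
    using M by (intro tendsto_powr tendsto_const inv) auto
  then have "((\<lambda>b. M powr (1 / b)) \<longlongrightarrow> 1) at_top"
    using M by simp
  from tendsto_mult[OF this tendsto_const[of x]]
  have up: "((\<lambda>b. M powr (1 / b) * x) \<longlongrightarrow> x) at_top" by simp
  have N: "((\<lambda>b. norm_beta b q) \<longlongrightarrow> x) at_top"
  proof (rule tendsto_sandwich[OF _ _ tendsto_const up])
    show "\<forall>\<^sub>F b in at_top. x \<le> norm_beta b q"
      using eventually_gt_at_top[of 0] by eventually_elim (rule lower)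
    show "\<forall>\<^sub>F b in at_top. norm_beta b q \<le> M powr (1 / b) * x"
      using eventually_gt_at_top[of 0] by eventually_elim (rule upper)
  qed
  have D: "((\<lambda>b. M powr (1 / b - 1)) \<longlongrightarrow> 1 / M) at_top"
  proof -
    have "((\<lambda>b. M powr (1 / b - 1)) \<longlongrightarrow> M powr (0 - 1)) at_top"
      using M by (intro tendsto_intros inv) auto
    then show ?thesis using M by (simp add: powr_minus_divide)
  qed
  have "((\<lambda>b. Hr_fin b q) \<longlongrightarrow> (x - 1) / (1 / M - 1)) at_top"
    unfolding Hr_fin_def M_def[symmetric] using M by (intro tendsto_intros N D) auto
  moreover have "(x - 1) / (1 / M - 1) = 1 / (1 - 1 / M) * (1 - x)"
    using M by (simp add: divide_simps) (simp add: algebra_simps)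
  ultimately show ?thesis by (simp add: M_def x_def)
qed

lemma Hr_0:
  fixes q :: "real ^ 'm::finite"
  assumes "CARD('m) \<ge> 2" "q \<in> prob_simplex"
  shows "Hr 0 q = real CARD('m) * (\<Prod>j\<in>UNIV. q $ j) powr (1 / real CARD('m))"
  using tendsto_Lim[OF _ Hr_fin_tendsto_0[OF assms]] by (simp add: Hr_def)

lemma Hr_1:
  fixes q :: "real ^ 'm::finite"
  assumes "CARD('m) \<ge> 2" "q \<in> prob_simplex"
  shows "Hr 1 q = - (1 / ln (real CARD('m))) * (\<Sum>j\<in>UNIV. q $ j * ln (q $ j))"
  using tendsto_Lim[OF _ Hr_fin_tendsto_1[OF assms]] by (simp add: Hr_def)

lemma Hr_infinity:
  fixes q :: "real ^ 'm::finite"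
  assumes "CARD('m) \<ge> 2" "q \<in> prob_simplex"
  shows "Hr \<infinity> q = 1 / (1 - 1 / real CARD('m)) * (1 - (MAX j\<in>UNIV. q $ j))"
  using tendsto_Lim[OF _ Hr_fin_tendsto_infinity[OF assms]] by (simp add: Hr_def)

subsection \<open>Convexity of the composite loss\<close>

lemma convex_on_exp:
  assumes "convex_on S f"
  shows "convex_on S (\<lambda>x. exp (f x))"
  unfolding convex_on_def
proof (intro conjI ballI allI impI)
  show "convex S" using assms by (rule convex_on_imp_convex)
  fix x y and u v :: real assume *: "x \<in> S" "y \<in> S" "0 \<le> u" "0 \<le> v" "u + v = 1"
  have "exp (f (u *\<^sub>R x + v *\<^sub>R y)) \<le> exp (u * f x + v * f y)"
    using assms * by (simp add: convex_on_def)
  also have "\<dots> \<le> u * exp (f x) + v * exp (f y)"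
    using exp_convex * by (auto simp: convex_on_def)
  finally show "exp (f (u *\<^sub>R x + v *\<^sub>R y)) \<le> u * exp (f x) + v * exp (f y)" .
qed

text \<open>Normalising by \<open>Z\<close> reduces the claim to convexity of exp: applied to each
  \<open>a k x - ln (Z x)\<close>, it bounds the terms by mixtures of weights that sum to 1, so the
  total is at most u + v = 1.\<close>

lemma convex_on_ln_sum_exp:
  assumes "finite K" "K \<noteq> {}" and cvx: "\<And>k. k \<in> K \<Longrightarrow> convex_on S (a k)"
  shows "convex_on S (\<lambda>x. ln (\<Sum>k\<in>K. exp (a k x :: real)))"
  unfolding convex_on_def
proof (intro conjI ballI allI impI)
  show "convex S" using assms by (meson convex_on_imp_convex ex_in_conv)
  fix x y and u v :: real assume *: "x \<in> S" "y \<in> S" "0 \<le> u" "0 \<le> v" "u + v = 1"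
  define Z where "Z x = (\<Sum>k\<in>K. exp (a k x))" for x
  have Z: "Z x > 0" for x unfolding Z_def using assms by (intro sum_pos) auto
  have "exp (a k (u *\<^sub>R x + v *\<^sub>R y) - (u * ln (Z x) + v * ln (Z y)))
      \<le> u * (exp (a k x) / Z x) + v * (exp (a k y) / Z y)" if "k \<in> K" for k
  proof -
    have "exp (a k (u *\<^sub>R x + v *\<^sub>R y) - (u * ln (Z x) + v * ln (Z y)))
        \<le> exp (u * (a k x - ln (Z x)) + v * (a k y - ln (Z y)))"
      using cvx[OF that] * by (simp add: convex_on_def algebra_simps)
    also have "\<dots> \<le> u * exp (a k x - ln (Z x)) + v * exp (a k y - ln (Z y))"
      using exp_convex * by (auto simp: convex_on_def)
    finally show ?thesis using Z by (simp add: exp_diff)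
  qed
  then have "(\<Sum>k\<in>K. exp (a k (u *\<^sub>R x + v *\<^sub>R y) - (u * ln (Z x) + v * ln (Z y))))
      \<le> (\<Sum>k\<in>K. u * (exp (a k x) / Z x) + v * (exp (a k y) / Z y))"
    by (rule sum_mono)
  then have "Z (u *\<^sub>R x + v *\<^sub>R y) / exp (u * ln (Z x) + v * ln (Z y)) \<le> u + v"
    by (simp add: exp_diff sum.distrib less_imp_neq[OF Z, symmetric]
        flip: Z_def sum_divide_distrib sum_distrib_left)
  then have "Z (u *\<^sub>R x + v *\<^sub>R y) \<le> exp (u * ln (Z x) + v * ln (Z y))"
    using Z[of x] Z[of y] * by simp
  then have "ln (Z (u *\<^sub>R x + v *\<^sub>R y)) \<le> u * ln (Z x) + v * ln (Z y)"
    using Z by (metis ln_exp ln_le_cancel_iff exp_gt_zero)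
  then show "ln (\<Sum>k\<in>K. exp (a k (u *\<^sub>R x + v *\<^sub>R y)))
      \<le> u * ln (\<Sum>k\<in>K. exp (a k x)) + v * ln (\<Sum>k\<in>K. exp (a k y))"
    by (simp add: Z_def)
qed

lemma convex_on_UNIV_bounded_above_imp_le:
  fixes f :: "'a::real_vector \<Rightarrow> real"
  assumes cvx: "convex_on UNIV f" and C: "\<And>x. f x \<le> C"
  shows "f x \<le> f y"
proof -
  have le: "f x \<le> (1 - t) * f y + t * C" if "0 < t" "t \<le> 1" for t
  proof -
    \<comment> \<open>\<open>z\<close> is the point on the ray from \<open>y\<close> through
      \<open>x\<close> for which \<open>x\<close> divides the segment in proportion t. As t tends to
      0 the weight of the bound \<open>C\<close> disappears.\<close>
    define z where "z = y + (1 / t) *\<^sub>R (x - y)"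
    have "x = (1 - t) *\<^sub>R y + t *\<^sub>R z"
      using that by (simp add: z_def algebra_simps)
    then have "f x \<le> (1 - t) * f y + t * f z"
      using convex_onD[OF cvx, of t y z] that by simp
    also have "\<dots> \<le> (1 - t) * f y + t * C" using C that by simp
    finally show ?thesis .
  qed
  have "((\<lambda>t. (1 - t) * f y + t * C) \<longlongrightarrow> (1 - 0) * f y + 0 * C) (at_right 0)"
    by (intro tendsto_intros)
  moreover have "\<forall>\<^sub>F t in at_right (0::real). f x \<le> (1 - t) * f y + t * C"
    using le by (intro eventually_at_rightI[of 0 1]) auto
  ultimately show ?thesis
    using tendsto_lowerbound[of _ _ "at_right (0::real)" "f x"] by fastforce
qed

lemma convex_on_UNIV_linear:
  fixes f :: "'a::real_vector \<Rightarrow> real"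
  assumes "linear f"
  shows "convex_on UNIV f"
  by (simp add: convex_on_def linear_add[OF assms] linear_scale[OF assms])

section \<open>Composite losses under the logistic link\<close>

lemma mlogit_link_ratio:
  fixes h :: "real ^ 'm::finite"
  shows "mlogit_link h $ k / mlogit_link h $ j = exp (h $ k - h $ j)"
proof -
  have "(\<Sum>k\<in>UNIV. exp (h $ k)) > 0" by (intro sum_pos) auto
  then show ?thesis by (simp add: mlogit_link_def exp_diff)
qed

lemma mlogit_link_pos: "mlogit_link (h :: real ^ 'm::finite) $ j > 0"
  by (auto simp: mlogit_link_def intro!: divide_pos_pos sum_pos)

lemma mlogit_link_in_prob_simplex: "mlogit_link (h :: real ^ 'm::finite) \<in> prob_simplex"
proof -
  have "(\<Sum>k\<in>UNIV. exp (h $ k)) > 0" by (intro sum_pos) auto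
  then have "(\<Sum>j\<in>UNIV. mlogit_link h $ j) = 1"
    by (simp add: mlogit_link_def sum_divide_distrib[symmetric])
  then show ?thesis by (simp add: prob_simplex_def mlogit_link_pos less_imp_le)
qed

lemma ln_mlogit_link:
  fixes h :: "real ^ 'm::finite"
  shows "ln (mlogit_link h $ j) = - ln (\<Sum>k\<in>UNIV. exp (h $ k - h $ j))"
proof -
  have "(\<Sum>k\<in>UNIV. exp (h $ k)) > 0" by (intro sum_pos) auto
  then show ?thesis
    by (simp add: mlogit_link_def ln_div exp_diff sum_divide_distrib[symmetric])
qed

text \<open>The loss depends only on the ratios of the components, which are
  \<open>exp (h $ k - h $ j)\<close>. Factoring \<open>q $ j\<close> out of the norm cancels it, and
  the link is positive, so the infinite branch never arises.\<close>

lemma Lr_fin_mlogit_link: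
  fixes h :: "real ^ 'm::finite"
  assumes "b \<noteq> 0"
  shows "Lr_fin b j (mlogit_link h) =
    ereal (((\<Sum>k\<in>UNIV. exp (b * (h $ k - h $ j))) powr (1 / b - 1) - 1) /
           (real CARD('m) powr (1 / b - 1) - 1))"
proof -
  define q where "q = mlogit_link h"
  have pos: "q $ k > 0" for k by (simp add: q_def mlogit_link_pos)
  define S where "S = (\<Sum>k\<in>UNIV. exp (b * (h $ k - h $ j)))"
  have S: "S > 0" unfolding S_def by (intro sum_pos) auto
  have "(q $ k) powr b = (q $ j) powr b * exp (b * (h $ k - h $ j))" for k
  proof -
    have "q $ k = q $ j * exp (h $ k - h $ j)"
      using pos[of j] mlogit_link_ratio[of h k j] by (simp add: q_def field_simps)
    then show ?thesis using pos[of j] by (simp add: powr_mult powr_def[of "exp _"])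
  qed
  then have "(\<Sum>k\<in>UNIV. (q $ k) powr b) = (q $ j) powr b * S"
    unfolding S_def sum_distrib_left by (rule sum.cong[OF refl])
  then have "norm_beta b q = q $ j * S powr (1 / b)"
    using pos[of j] S assms by (simp add: norm_beta_def powr_mult powr_powr)
  then have "q $ j / norm_beta b q = S powr (- (1 / b))"
    using pos[of j] by (simp add: powr_minus divide_simps)
  also have "\<dots> powr (b - 1) = S powr (1 / b - 1)"
  proof -
    have "- (1 / b) * (b - 1) = 1 / b - 1" using assms by (simp add: field_simps)
    then show ?thesis by (simp only: powr_powr)
  qed
  finally show ?thesis
    using pos[of j] by (simp add: Lr_fin_def q_def[symmetric] S_def[symmetric])
qed

lemma linear_coordinate_difference: "linear (\<lambda>h :: real ^ 'm::finite. h $ k - h $ j)"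
  by (simp add: linear_iff algebra_simps)

text \<open>The real function \<open>f\<close> expresses that the composite loss is finite, so that
  convexity makes sense for it.\<close>

lemma composite_loss_convex:
  fixes am :: "real ^ 'm \<Rightarrow> 'm::finite"
  assumes m: "CARD('m) \<ge> 2" and \<beta>: "\<beta> \<in> {0..1}"
  shows "\<exists>f. (\<forall>h. Lr am \<beta> j (mlogit_link h) = ereal (f h)) \<and> convex_on UNIV f"
proof -
  have [simp]: "mlogit_link h $ j \<noteq> 0" for h :: "real ^ 'm" using mlogit_link_pos[of h j] by simp
  consider "\<beta> = 0" | "\<beta> = 1" | b where "\<beta> = ereal b" "0 < b" "b < 1"
    using \<beta> by (cases \<beta>) (auto simp: less_le)
  then show ?thesis
  proof cases
    case 1
    \<comment> \<open>The m-th root of a product of exponentials is the exponential of the average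
      exponent, which is linear in \<open>h\<close>.\<close>
    define f where "f h = exp ((\<Sum>k\<in>UNIV. h $ k - h $ j) / real CARD('m))" for h :: "real ^ 'm"
    have "linear (\<lambda>h :: real ^ 'm. (\<Sum>k\<in>UNIV. h $ k - h $ j) / real CARD('m))"
      by (simp add: linear_iff sum.distrib sum_subtractf sum_distrib_left[symmetric] field_simps)
    then have "convex_on UNIV f"
      unfolding f_def by (intro convex_on_exp convex_on_UNIV_linear)
    moreover have "Lr am \<beta> j (mlogit_link h) = ereal (f h)" for h
      by (simp add: 1 Lr_def f_def mlogit_link_ratio exp_sum[symmetric] powr_def[of "exp _"])
    ultimately show ?thesis by blast
  next
    case 2
    define f where "f h = 1 / ln (real CARD('m)) * ln (\<Sum>k\<in>UNIV. exp (h $ k - h $ j))" for h :: "real ^ 'm"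
    have "convex_on UNIV f"
      unfolding f_def using m
      by (intro convex_on_cmul convex_on_ln_sum_exp convex_on_UNIV_linear
          linear_coordinate_difference) auto
    moreover have "Lr am \<beta> j (mlogit_link h) = ereal (f h)" for h
      by (simp add: 2 Lr_def f_def ln_mlogit_link)
    ultimately show ?thesis by blast
  next
    case (3 b)
    define D where "D = real CARD('m) powr (1 / b - 1) - 1"
    have D: "D > 0"
      using 3 m powr_less_mono[of 0 "1 / b - 1" "real CARD('m)"] by (simp add: D_def)
    \<comment> \<open>Subtraction of 1 is written as addition of a constant to match
      \<open>convex_on_add\<close>.\<close>
    define f where "f h = 1 / D *
        (exp ((1 / b - 1) * ln (\<Sum>k\<in>UNIV. exp (b * (h $ k - h $ j)))) + (- 1))" for h :: "real ^ 'm"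
    have "convex_on UNIV (\<lambda>h. exp ((1 / b - 1) * ln (\<Sum>k\<in>UNIV. exp (b * (h $ k - h $ j)))))"
      using 3
      by (intro convex_on_exp convex_on_cmul convex_on_ln_sum_exp convex_on_UNIV_linear
          linear_coordinate_difference) auto
    then have "convex_on UNIV f"
      unfolding f_def using D
      by (intro convex_on_cmul convex_on_add) (auto simp: convex_on_const)
    moreover have "Lr am \<beta> j (mlogit_link h) = ereal (f h)" for h
    proof -
      have "(\<Sum>k\<in>UNIV. exp (b * (h $ k - h $ j))) > 0" by (intro sum_pos) auto
      then show ?thesis
        using 3 by (simp add: Lr_def f_def Lr_fin_mlogit_link D_def powr_def[of "sum _ _"])
    qed
    ultimately show ?thesis by blast
  qed
qed

lemma composite_loss_not_convex:
  fixes am :: "real ^ 'm \<Rightarrow> 'm::finite"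
  assumes m: "CARD('m) \<ge> 2" and \<beta>: "\<beta> > 1"
    and am: "\<And>q. q \<in> prob_simplex \<Longrightarrow> is_arg_max (\<lambda>k. q $ k) (\<lambda>k. True) (am q)"
  shows "\<exists>f. (\<forall>h. Lr am \<beta> j (mlogit_link h) = ereal (f h)) \<and> \<not> convex_on UNIV f"
proof -
  have "UNIV \<noteq> {j}"
  proof
    assume "UNIV = {j}"
    then have "CARD('m) = card {j}" by (rule arg_cong)
    with m show False by simp
  qed
  then obtain i where i: "i \<noteq> j" by auto
  consider "\<beta> = \<infinity>" | b where "\<beta> = ereal b" "b > 1"
    using \<beta> by (cases \<beta>) auto
  then show ?thesis
  proof cases
    case 1
    define c where "c = 1 / (1 - 1 / real CARD('m))"
    have c: "c > 0" using m by (simp add: c_def)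
    define f where "f h = c * of_bool (j \<noteq> am (mlogit_link h))" for h
    have best: "h $ k \<le> h $ am (mlogit_link h)" for h k
    proof -
      have "mlogit_link h $ k \<le> mlogit_link h $ am (mlogit_link h)"
        using am[OF mlogit_link_in_prob_simplex[of h]] by (auto simp: is_arg_max_def not_less)
      moreover have "(\<Sum>k\<in>UNIV. exp (h $ k)) > 0" by (intro sum_pos) auto
      ultimately show ?thesis by (simp add: mlogit_link_def divide_le_cancel)
    qed
    \<comment> \<open>A unit vector has a unique maximal coordinate, so the choice made by
      \<open>am\<close> is forced at both test points.\<close>
    have "f (axis j 1) = 0"
      using best[of "axis j 1" j] by (auto simp: f_def axis_def split: if_splits)
    moreover have "f (axis i 1) = c"
      using best[of "axis i 1" i] i by (auto simp: f_def axis_def split: if_splits)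
    moreover have "f h \<le> c" for h using c by (simp add: f_def)
    ultimately have "\<not> convex_on UNIV f"
      using convex_on_UNIV_bounded_above_imp_le[of f c "axis i 1" "axis j 1"] c by auto
    moreover have "Lr am \<beta> j (mlogit_link h) = ereal (f h)" for h
      by (simp add: 1 Lr_def f_def c_def)
    ultimately show ?thesis by blast
  next
    case (2 b)
    define p where "p = 1 / b - 1"
    \<comment> \<open>Both signs of the quotient are flipped because \<open>p < 0\<close>: now
      \<open>D\<close> is positive, and \<open>S h powr p \<ge> 0\<close> gives the upper bound
      \<open>1 / D\<close>.\<close>
    define D where "D = 1 - real CARD('m) powr p"
    have p: "p < 0" using 2 by (simp add: p_def)
    have D: "D > 0"
      using p m powr_less_mono[of p 0 "real CARD('m)"] by (simp add: D_def)
    define S where "S h = (\<Sum>k\<in>UNIV. exp (b * (h $ k - h $ j)))" for h :: "real ^ 'm"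
    define f where "f h = (1 - S h powr p) / D" for h
    have Spos: "S h > 0" for h unfolding S_def by (intro sum_pos) auto
    \<comment> \<open>Raising coordinate j lowers every term with \<open>k \<noteq> j\<close> and
      keeps the term \<open>k = j\<close> at 1; the label \<open>i\<close> makes the inequality
      strict.\<close>
    have "S (axis j 1) < S 0"
      unfolding S_def using 2 i by (intro sum_strict_mono_ex1) (auto simp: axis_def)
    then have "S 0 powr p < S (axis j 1) powr p"
      using p Spos by (simp add: powr_less_mono2_neg)
    then have "f (axis j 1) < f 0" using D by (simp add: f_def divide_strict_right_mono)
    moreover have "f h \<le> 1 / D" for h using D by (simp add: f_def divide_right_mono)
    ultimately have "\<not> convex_on UNIV f"
      using convex_on_UNIV_bounded_above_imp_le[of f "1 / D" 0 "axis j 1"] by auto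
    moreover have "Lr am \<beta> j (mlogit_link h) = ereal (f h)" for h
    proof -
      have "(x - 1) / (y - 1) = (1 - x) / (1 - y)" for x y :: real
        by (metis minus_diff_eq minus_divide_divide)
      then show ?thesis
        using 2 by (simp add: Lr_def f_def Lr_fin_mlogit_link S_def D_def p_def one_ereal_def)
    qed
    ultimately show ?thesis by blast
  qed
qed

theorem proposition4:
  fixes am :: "real ^ 'm \<Rightarrow> 'm::finite"
  assumes m: "CARD('m) \<ge> 2"
    and am: "\<And>q. q \<in> prob_simplex \<Longrightarrow> is_arg_max (\<lambda>k. q $ k) (\<lambda>k. True) (am q)"
  shows
    "((\<forall>q \<in> (prob_simplex :: (real ^ 'm) set).
         ((\<lambda>b. Hr_fin b q) \<longlongrightarrow> Hr 0 q) (at_right 0) \<and>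
         Hr 0 q = real CARD('m) * (\<Prod>j\<in>UNIV. q $ j) powr (1 / real CARD('m))) \<and>
      (\<forall>j. \<forall>q \<in> prob_simplex. Lr am 0 j q =
         (if q $ j = 0 then \<infinity>
          else ereal ((\<Prod>k\<in>UNIV. q $ k / q $ j) powr (1 / real CARD('m))))) \<and>
      corresponds_to (Lr am 0) (Hr 0))
     \<and>
     ((\<forall>q \<in> (prob_simplex :: (real ^ 'm) set).
         Hr (ereal (1/2)) q = 1 / (real CARD('m) - 1) * (norm_beta (1/2) q - 1)) \<and>
      (\<forall>j. \<forall>q \<in> prob_simplex. Lr am (ereal (1/2)) j q =
         (if q $ j = 0 then \<infinity>
          else ereal (1 / (real CARD('m) - 1) * (\<Sum>k\<in>UNIV - {j}. sqrt (q $ k / q $ j))))) \<and>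
      corresponds_to (Lr am (ereal (1/2))) (Hr (ereal (1/2))))
     \<and>
     ((\<forall>q \<in> (prob_simplex :: (real ^ 'm) set).
         ((\<lambda>b. Hr_fin b q) \<longlongrightarrow> Hr 1 q) (at 1) \<and>
         Hr 1 q = - (1 / ln (real CARD('m))) * (\<Sum>j\<in>UNIV. q $ j * ln (q $ j))) \<and>
      (\<forall>j. \<forall>q \<in> prob_simplex. Lr am 1 j q =
         (if q $ j = 0 then \<infinity> else ereal (- (1 / ln (real CARD('m))) * ln (q $ j)))) \<and>
      corresponds_to (Lr am 1) (Hr 1))
     \<and>
     ((\<forall>q \<in> (prob_simplex :: (real ^ 'm) set).
         ((\<lambda>b. Hr_fin b q) \<longlongrightarrow> Hr \<infinity> q) at_top \<and>
         Hr \<infinity> q = 1 / (1 - 1 / real CARD('m)) * (1 - (MAX j\<in>UNIV. q $ j))) \<and>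
      (\<forall>j. \<forall>q \<in> prob_simplex. Lr am \<infinity> j q =
         ereal (1 / (1 - 1 / real CARD('m)) * of_bool (j \<noteq> am q))) \<and>
      corresponds_to (Lr am \<infinity>) (Hr \<infinity>))
     \<and>
     (\<forall>\<beta> \<in> {0..1}. \<forall>j. \<exists>f.
        (\<forall>h. Lr am \<beta> j (mlogit_link h) = ereal (f h)) \<and> convex_on UNIV f)
     \<and>
     (\<forall>\<beta> > 1. \<forall>j. \<exists>f.
        (\<forall>h. Lr am \<beta> j (mlogit_link h) = ereal (f h)) \<and> \<not> convex_on UNIV f)"
proof (intro conjI ballI allI impI)
  show "corresponds_to (Lr am 0) (Hr 0)"
    using corresponds_to_exponential[of am] by (simp add: corresponds_to_cong[OF Hr_0[OF m]])
  show "corresponds_to (Lr am 1) (Hr 1)"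
    using corresponds_to_log[OF m, of am] by (simp add: corresponds_to_cong[OF Hr_1[OF m]])
  show "corresponds_to (Lr am \<infinity>) (Hr \<infinity>)"
    using corresponds_to_zero_one[OF am] by (simp add: corresponds_to_cong[OF Hr_infinity[OF m]])
  show "corresponds_to (Lr am (ereal (1/2))) (Hr (ereal (1/2)))"
    by (rule corresponds_to_pairwise[OF m])
  show "Lr am \<infinity> j q = ereal (1 / (1 - 1 / real CARD('m)) * of_bool (j \<noteq> am q))" for j q
    by (simp add: Lr_def)
  show "Lr am (ereal (1/2)) j q = (if q $ j = 0 then \<infinity>
      else ereal (1 / (real CARD('m) - 1) * (\<Sum>k\<in>UNIV - {j}. sqrt (q $ k / q $ j))))"
    if "q \<in> prob_simplex" for j q
    using m that by (rule Lr_half)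
  show "Hr (ereal (1/2)) q = 1 / (real CARD('m) - 1) * (norm_beta (1/2) q - 1)" for q :: "real ^ 'm"
    by (rule Hr_half)
  show "Lr am 0 j q = (if q $ j = 0 then \<infinity>
      else ereal ((\<Prod>k\<in>UNIV. q $ k / q $ j) powr (1 / real CARD('m))))" for j q
    by (simp add: Lr_def)
  show "Lr am 1 j q = (if q $ j = 0 then \<infinity>
      else ereal (- (1 / ln (real CARD('m))) * ln (q $ j)))" for j q
    by (simp add: Lr_def)
  fix q :: "real ^ 'm" assume q: "q \<in> prob_simplex"
  show Hr0: "Hr 0 q = real CARD('m) * (\<Prod>j\<in>UNIV. q $ j) powr (1 / real CARD('m))"
    by (rule Hr_0[OF m q])
  show Hr1: "Hr 1 q = - (1 / ln (real CARD('m))) * (\<Sum>j\<in>UNIV. q $ j * ln (q $ j))"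
    by (rule Hr_1[OF m q])
  show Hri: "Hr \<infinity> q = 1 / (1 - 1 / real CARD('m)) * (1 - (MAX j\<in>UNIV. q $ j))"
    by (rule Hr_infinity[OF m q])
  show "((\<lambda>b. Hr_fin b q) \<longlongrightarrow> Hr 0 q) (at_right 0)"
    unfolding Hr0 by (rule Hr_fin_tendsto_0[OF m q])
  show "((\<lambda>b. Hr_fin b q) \<longlongrightarrow> Hr 1 q) (at 1)"
    unfolding Hr1 by (rule Hr_fin_tendsto_1[OF m q])
  show "((\<lambda>b. Hr_fin b q) \<longlongrightarrow> Hr \<infinity> q) at_top"
    unfolding Hri by (rule Hr_fin_tendsto_infinity[OF m q])
qed (use composite_loss_convex[OF m] composite_loss_not_convex[OF m _ am] in blast)+

end
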